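(* Let $n\ge 2$. Among all trees $T$ on $n$ vertices, the path graph $P_n$ minimizes $b(T)$ and the star graph $S_n$ maximizes $b(T)$; that is, $b(P_n)\le b(T)\le b(S_n)$ for every tree $T$ on $n$ vertices. Moreover, $S_n$ is the unique tree (up to isomorphism) on $n$ vertices that attains the maximum.
   Context: Graphs are finite, simple, undirected and unweighted. For a graph $G$ with vertex set $V(G)$, $|V(G)|\ge 2$, and edge set $E(G)$, the $\ell_1$-Fiedler value is $$b(G)=\min\Big\{\sum_{uv\in E(G)}|x_u-x_v| : x\in\mathbb{R}^{V(G)},\ \sum_{v\in V(G)}x_v=0,\ \sum_{v\in V(G)}|x_v|=1\Big\}.$$ $P_n$ is the path on $n$ vertices and $S_n$ is the star on $n$ vertices (one vertex adjacent to the $n-1$ others, with no other edges). *)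

theory Defs
  imports "HOL-Analysis.Analysis"
begin

record 'a ugraph =
  verts :: "'a set"
  edges :: "'a set set"

definition simple_graph :: "'a ugraph \<Rightarrow> bool" where
  "simple_graph G \<longleftrightarrow> finite (verts G) \<and> (\<forall>e\<in>edges G. e \<subseteq> verts G \<and> card e = 2)"

definition adj :: "'a ugraph \<Rightarrow> 'a \<Rightarrow> 'a \<Rightarrow> bool" where
  "adj G u v \<longleftrightarrow> {u, v} \<in> edges G"

definition connected_graph :: "'a ugraph \<Rightarrow> bool" where
  "connected_graph G \<longleftrightarrow> verts G \<noteq> {} \<and> (\<forall>u\<in>verts G. \<forall>v\<in>verts G. (adj G)\<^sup>*\<^sup>* u v)"

(* p lists the vertices of the cycle in order, without repeating the first one at the end *)
definition is_cycle :: "'a ugraph \<Rightarrow> 'a list \<Rightarrow> bool" where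
  "is_cycle G p \<longleftrightarrow>
     length p \<ge> 3 \<and> distinct p \<and> successively (adj G) p \<and> adj G (last p) (hd p)"

definition is_tree :: "'a ugraph \<Rightarrow> bool" where
  "is_tree G \<longleftrightarrow> simple_graph G \<and> connected_graph G \<and> (\<nexists>p. is_cycle G p)"

definition graph_iso :: "'a ugraph \<Rightarrow> 'b ugraph \<Rightarrow> bool" where
  "graph_iso G H \<longleftrightarrow>
     (\<exists>f. bij_betw f (verts G) (verts H) \<and>
          (\<forall>u\<in>verts G. \<forall>v\<in>verts G. adj G u v \<longleftrightarrow> adj H (f u) (f v)))"

definition path_graph :: "nat \<Rightarrow> nat ugraph" where
  "path_graph n = \<lparr>verts = {..<n}, edges = {{i, Suc i} | i. Suc i < n}\<rparr>"

definition star_graph :: "nat \<Rightarrow> nat ugraph" where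
  "star_graph n = \<lparr>verts = {..<n}, edges = {{0, i} | i. 0 < i \<and> i < n}\<rparr>"

(* The term |x_u - x_v| of the edge e = uv; see edge_diff_doubleton. *)
definition edge_diff :: "('a \<Rightarrow> real) \<Rightarrow> 'a set \<Rightarrow> real" where
  "edge_diff x e = (THE d. \<exists>u v. e = {u, v} \<and> d = \<bar>x u - x v\<bar>)"

lemma edge_diff_doubleton: "edge_diff x {u, v} = \<bar>x u - x v\<bar>"
  unfolding edge_diff_def by (rule the_equality) (auto simp: doubleton_eq_iff)

definition l1_energy :: "'a ugraph \<Rightarrow> ('a \<Rightarrow> real) \<Rightarrow> real" where
  "l1_energy G x = (\<Sum>e\<in>edges G. edge_diff x e)"

(* Vectors indexed by the vertices are functions on the whole vertex type;
   their values outside the vertex set play no role. *)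
definition l1_feasible :: "'a ugraph \<Rightarrow> ('a \<Rightarrow> real) set" where
  "l1_feasible G = {x. (\<Sum>v\<in>verts G. x v) = 0 \<and> (\<Sum>v\<in>verts G. \<bar>x v\<bar>) = 1}"

(* LEAST is the minimum of the set of attained values; it exists by l1_fiedler_is_min. *)
definition l1_fiedler :: "'a ugraph \<Rightarrow> real" where
  "l1_fiedler G = (LEAST r. r \<in> l1_energy G ` l1_feasible G)"

lemma l1_fiedler_is_min:
  fixes G :: "'a ugraph"
  assumes G: "simple_graph G" and "card (verts G) \<ge> 2"
  shows "l1_fiedler G \<in> l1_energy G ` l1_feasible G"
    and "\<And>x. x \<in> l1_feasible G \<Longrightarrow> l1_fiedler G \<le> l1_energy G x"
proof -
  let ?V = "verts G"
  have fin: "finite ?V" using G by (simp add: simple_graph_def)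
  define K :: "('a \<Rightarrow> real) set"
    where "K = (\<Pi>\<^sub>E i\<in>UNIV. if i \<in> ?V then {-1..1} else {0})"
  have "compact K"
  proof -
    have "compactin (product_topology (\<lambda>i. euclidean) UNIV) K"
      unfolding K_def by (subst compactin_PiE) auto
    then show ?thesis by (simp add: euclidean_product_topology)
  qed
  moreover have "closed (l1_feasible G)"
    unfolding l1_feasible_def
    by (intro closed_Collect_conj closed_Collect_eq continuous_intros) auto
  ultimately have comp: "compact (K \<inter> l1_feasible G)" by (rule compact_Int_closed)
  have restr: "\<exists>y \<in> K \<inter> l1_feasible G. l1_energy G y = l1_energy G x"
    if x: "x \<in> l1_feasible G" for x
  proof
    define y where "y = (\<lambda>v. if v \<in> ?V then x v else 0)"
    have "\<bar>x v\<bar> \<le> 1" if "v \<in> ?V" for v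
      using x member_le_sum[of v ?V "\<lambda>v. \<bar>x v\<bar>"] fin that by (auto simp: l1_feasible_def)
    then have "y \<in> K" by (auto simp: K_def y_def abs_le_iff minus_le_iff)
    moreover have "y \<in> l1_feasible G" using x by (simp add: l1_feasible_def y_def)
    ultimately show "y \<in> K \<inter> l1_feasible G" by simp
    show "l1_energy G y = l1_energy G x"
      unfolding l1_energy_def
    proof (rule sum.cong)
      fix e assume "e \<in> edges G"
      then have "e \<subseteq> ?V" "card e = 2" using G by (auto simp: simple_graph_def)
      then show "edge_diff y e = edge_diff x e"
        by (auto simp: card_2_iff edge_diff_doubleton y_def)
    qed simp
  qed
  have "K \<inter> l1_feasible G \<noteq> {}"
  proof -
    obtain A where "A \<subseteq> ?V" "card A = 2"
      using assms(2) by (metis obtain_subset_with_card_n)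
    then obtain a b where ab: "a \<in> ?V" "b \<in> ?V" "a \<noteq> b" by (auto simp: card_2_iff)
    define x :: "'a \<Rightarrow> real" where "x = (\<lambda>v. (if v = a then 1/2 else 0) - (if v = b then 1/2 else 0))"
    have "\<bar>x v\<bar> = (if v = a then 1/2 else 0) + (if v = b then 1/2 else 0)" for v
      using ab by (auto simp: x_def)
    then have "x \<in> l1_feasible G"
      using ab fin by (auto simp: l1_feasible_def x_def sum.distrib sum_subtractf)
    then show ?thesis using restr by blast
  qed
  moreover have "continuous_on (K \<inter> l1_feasible G) (l1_energy G)"
    unfolding l1_energy_def
  proof (rule continuous_on_sum)
    fix e assume "e \<in> edges G"
    then obtain u v where e: "e = {u, v}" using G by (auto simp: simple_graph_def card_2_iff)
    show "continuous_on (K \<inter> l1_feasible G) (\<lambda>x. edge_diff x e)"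
      unfolding e edge_diff_doubleton
      by (intro continuous_intros; rule continuous_on_subset[OF continuous_on_product_coordinates]; simp)
  qed
  ultimately obtain z where z: "z \<in> K \<inter> l1_feasible G"
    and "\<forall>y \<in> K \<inter> l1_feasible G. l1_energy G z \<le> l1_energy G y"
    using continuous_attains_inf[OF comp] by metis
  with restr have min: "l1_energy G z \<le> l1_energy G x" if "x \<in> l1_feasible G" for x
    using that by metis
  have "l1_fiedler G = l1_energy G z"
    unfolding l1_fiedler_def by (rule Least_equality) (use z min in auto)
  then show "l1_fiedler G \<in> l1_energy G ` l1_feasible G"
    and "\<And>x. x \<in> l1_feasible G \<Longrightarrow> l1_fiedler G \<le> l1_energy G x"
    using z min by auto
qed

end

theory Submission
  imports Defs
begin

text \<open>
  Every edge \<open>e\<close> of a tree splits the \<open>n\<close> vertices into two sides of sizes \<open>s\<close> and \<open>n - s\<close>. The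
  vector that is constant on each side bounds \<open>b(T)\<close> above by \<open>n / (2 s (n - s))\<close>, hence by
  \<open>n / (2 (n - 1))\<close>, strictly unless one side is a single vertex. The star attains
  \<open>n / (2 (n - 1))\<close>, and a tree all of whose edges are pendant is a star. Conversely, in a
  connected graph the energy of \<open>x\<close> is at least \<open>max x - min x\<close>; if \<open>p\<close> entries are positive,
  their sum is \<open>1/2\<close> and that of the others is \<open>- 1/2\<close>, so
  \<open>max x - min x \<ge> 1 / (2 p) + 1 / (2 (n - p)) = n / (2 p (n - p))\<close>. The least such value,
  with \<open>p = n div 2\<close>, bounds \<open>b\<close> of the path above by cutting it at its middle edge.
\<close>

section \<open>Simple paths, cycles and edges\<close>

lemma rtranclp_imp_distinct_path:
  assumes "R\<^sup>*\<^sup>* u v"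
  obtains p where "p \<noteq> []" "distinct p" "successively R p" "hd p = u" "last p = v"
proof -
  have "\<exists>p. p \<noteq> [] \<and> distinct p \<and> successively R p \<and> hd p = u \<and> last p = v"
    using assms
  proof (induction rule: rtranclp_induct)
    case base
    then show ?case by (intro exI[of _ "[u]"]) auto
  next
    case (step y z)
    then obtain p where p: "p \<noteq> []" "distinct p" "successively R p" "hd p = u" "last p = y"
      by blast
    show ?case
    proof (cases "z \<in> set p")
      case True
      \<comment> \<open>A vertex visited before: the path is cut back to it.\<close>
      then obtain xs ys where "p = xs @ z # ys" by (meson split_list)
      with p show ?thesis
        by (intro exI[of _ "xs @ [z]"])
          (auto simp: successively_append_iff hd_append split: if_splits)
    next
      case False
      with p step show ?thesis
        by (intro exI[of _ "p @ [z]"]) (auto simp: successively_append_iff)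
    qed
  qed
  then show thesis using that by blast
qed

lemma adj_commute: "adj G u v \<longleftrightarrow> adj G v u"
  by (simp add: adj_def insert_commute)

text \<open>Rotating the cycle to start at \<open>w\<close> leaves the list \<open>q\<close> of its
  other vertices. It has at least two entries, so its two ends are distinct neighbours of
  \<open>w\<close>. This serves to show that paths and stars are acyclic.\<close>

lemma cycle_vertex_two_neighbours:
  assumes "is_cycle G p" "w \<in> set p"
  obtains a b where "a \<in> set p" "b \<in> set p" "a \<noteq> b" "adj G w a" "adj G w b"
proof -
  obtain xs ys where p: "p = xs @ w # ys" using assms(2) by (meson split_list)
  define q where "q = ys @ xs"
  have len: "length q \<ge> 2" and dist: "distinct q" and sub: "set q \<subseteq> set p"
    using assms(1) by (auto simp: is_cycle_def p q_def)
  then obtain a q' where q: "q = a # q'" and "q' \<noteq> []" by (cases q) fastforce+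
  then have "hd q \<noteq> last q" "hd q \<in> set p" "last q \<in> set p"
    using dist sub by auto
  moreover have "adj G w (hd q)"
    using assms(1) len adj_commute[of G]
    by (cases ys) (auto simp: is_cycle_def p q_def successively_append_iff hd_append split: if_splits)
  moreover have "adj G w (last q)"
    using assms(1) len adj_commute[of G]
    by (cases xs rule: rev_cases)
      (auto simp: is_cycle_def p q_def successively_append_iff successively_Cons split: if_splits)
  ultimately show thesis using that by blast
qed

lemma simple_graph_finite_edges:
  assumes "simple_graph G"
  shows "finite (edges G)"
proof (rule finite_subset)
  show "edges G \<subseteq> Pow (verts G)" using assms by (auto simp: simple_graph_def)
  show "finite (Pow (verts G))" using assms by (simp add: simple_graph_def)
qed

lemma simple_graph_adjD:
  assumes "simple_graph G" "adj G u v"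
  shows "u \<in> verts G" "v \<in> verts G" "u \<noteq> v"
  using assms by (fastforce simp: simple_graph_def adj_def)+

lemma simple_graph_edgeE:
  assumes "simple_graph G" "e \<in> edges G"
  obtains u v where "e = {u, v}"
  using assms unfolding simple_graph_def card_2_iff by blast

lemma edge_diff_nonneg:
  assumes "simple_graph G" "e \<in> edges G"
  shows "edge_diff x e \<ge> 0"
proof -
  obtain u v where "e = {u, v}" using assms by (rule simple_graph_edgeE)
  then show ?thesis by (simp add: edge_diff_doubleton)
qed

lemma connectedI_root:
  assumes "r \<in> verts G" "\<And>v. v \<in> verts G \<Longrightarrow> (adj G)\<^sup>*\<^sup>* r v"
  shows "connected_graph G"
proof -
  have "(adj G)\<^sup>*\<^sup>* v r" if "(adj G)\<^sup>*\<^sup>* r v" for v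
    using that
    by (induction rule: rtranclp_induct)
      (auto intro: converse_rtranclp_into_rtranclp adj_commute[THEN iffD1])
  then show ?thesis unfolding connected_graph_def
    using assms by (metis empty_iff rtranclp_trans)
qed

section \<open>The path and the star are trees\<close>

lemma adj_path_graph: "adj (path_graph n) i j \<longleftrightarrow> (j = Suc i \<and> j < n) \<or> (i = Suc j \<and> i < n)"
  by (auto simp: adj_def path_graph_def doubleton_eq_iff)

lemma adj_star_graph: "adj (star_graph n) i j \<longleftrightarrow> (i = 0 \<and> 0 < j \<and> j < n) \<or> (j = 0 \<and> 0 < i \<and> i < n)"
  by (auto simp: adj_def star_graph_def doubleton_eq_iff)

lemma is_tree_path_graph:
  assumes "n > 0"
  shows "is_tree (path_graph n)"
proof -
  have simple: "simple_graph (path_graph n)"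
    by (auto simp: simple_graph_def path_graph_def)
  have "(adj (path_graph n))\<^sup>*\<^sup>* 0 k" if "k < n" for k
    using that
  proof (induction k)
    case (Suc k)
    then have "adj (path_graph n) k (Suc k)" by (simp add: adj_path_graph)
    with Suc show ?case by (meson Suc_lessD rtranclp.rtrancl_into_rtrancl)
  qed simp
  then have conn: "connected_graph (path_graph n)"
    using assms by (intro connectedI_root[of 0]) (auto simp: path_graph_def)
  have "\<not> is_cycle (path_graph n) p" for p
  proof
    assume c: "is_cycle (path_graph n) p"
    then have ne: "set p \<noteq> {}" by (auto simp: is_cycle_def)
    \<comment> \<open>The largest vertex of a cycle could only have its predecessor as a neighbour
      on the cycle, but two are required.\<close>
    then have "Max (set p) \<in> set p" by simp
    then obtain a b where ab: "a \<in> set p" "b \<in> set p" "a \<noteq> b"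
      "adj (path_graph n) (Max (set p)) a" "adj (path_graph n) (Max (set p)) b"
      using cycle_vertex_two_neighbours[OF c] by metis
    moreover have "a \<le> Max (set p)" "b \<le> Max (set p)" using ab by auto
    ultimately show False by (auto simp: adj_path_graph)
  qed
  with simple conn show ?thesis by (simp add: is_tree_def)
qed

lemma is_tree_star_graph:
  assumes "n > 0"
  shows "is_tree (star_graph n)"
proof -
  have simple: "simple_graph (star_graph n)"
    by (auto simp: simple_graph_def star_graph_def)
  have "(adj (star_graph n))\<^sup>*\<^sup>* 0 k" if "k < n" for k
    using that by (cases "k = 0") (auto simp: adj_star_graph)
  then have conn: "connected_graph (star_graph n)"
    using assms by (intro connectedI_root[of 0]) (auto simp: star_graph_def)
  have "\<not> is_cycle (star_graph n) p" for p
  proof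
    assume c: "is_cycle (star_graph n) p"
    then have "p \<noteq> []" by (auto simp: is_cycle_def)
    then have "hd p \<in> set p" by simp
    then obtain a b where "a \<in> set p" "b \<in> set p" "a \<noteq> b"
      using cycle_vertex_two_neighbours[OF c] by metis
    \<comment> \<open>Such a vertex is adjacent to nothing but the centre \<open>0\<close>, so it
      lies on no cycle.\<close>
    then obtain w where "w \<in> set p" "w \<noteq> 0" by metis
    then show False
      using cycle_vertex_two_neighbours[OF c, of w] by (auto simp: adj_star_graph)
  qed
  with simple conn show ?thesis by (simp add: is_tree_def)
qed

section \<open>Energy bounds the spread of a vector\<close>

text \<open>This is the triangle inequality along \<open>p\<close>. Summing over the edges inside
  \<open>set p\<close> makes the induction work: by distinctness, the first edge of the path is not
  among the edges counted for the tail.\<close>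

lemma path_diff_le_energy_on_path:
  assumes G: "simple_graph G" and "p \<noteq> []" "distinct p" "successively (adj G) p"
  shows "\<bar>x (hd p) - x (last p)\<bar> \<le> (\<Sum>e\<in>{e \<in> edges G. e \<subseteq> set p}. edge_diff x e)"
  using assms(2-)
proof (induction p rule: induct_list012)
  case (3 u v p)
  let ?E = "\<lambda>q. {e \<in> edges G. e \<subseteq> set q}"
  have fin: "finite (?E q)" for q using simple_graph_finite_edges[OF G] by simp
  have IH: "\<bar>x v - x (last (v # p))\<bar> \<le> (\<Sum>e\<in>?E (v # p). edge_diff x e)"
    using 3 by simp
  have "\<bar>x u - x (last (v # p))\<bar> \<le> edge_diff x {u, v} + (\<Sum>e\<in>?E (v # p). edge_diff x e)"
    using IH by (simp add: edge_diff_doubleton)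
  also have "\<dots> = (\<Sum>e\<in>insert {u, v} (?E (v # p)). edge_diff x e)"
    using 3 fin[of "v # p"] by (subst sum.insert) auto
  also have "\<dots> \<le> (\<Sum>e\<in>?E (u # v # p). edge_diff x e)"
  proof (rule sum_mono2[OF fin])
    show "insert {u, v} (?E (v # p)) \<subseteq> ?E (u # v # p)"
      using 3 by (auto simp: adj_def)
  qed (use edge_diff_nonneg[OF G] in auto)
  finally show ?case by simp
qed (use edge_diff_nonneg[OF G] in \<open>auto intro!: sum_nonneg\<close>)

lemma diff_le_l1_energy:
  assumes G: "simple_graph G" "connected_graph G" and "u \<in> verts G" "v \<in> verts G"
  shows "\<bar>x u - x v\<bar> \<le> l1_energy G x"
proof -
  have "(adj G)\<^sup>*\<^sup>* u v" using assms by (auto simp: connected_graph_def)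
  then obtain p where p: "p \<noteq> []" "distinct p" "successively (adj G) p" "hd p = u" "last p = v"
    by (rule rtranclp_imp_distinct_path)
  have "\<bar>x u - x v\<bar> \<le> (\<Sum>e\<in>{e \<in> edges G. e \<subseteq> set p}. edge_diff x e)"
    using path_diff_le_energy_on_path[OF G(1) p(1-3), of x] p(4,5) by simp
  also have "\<dots> \<le> l1_energy G x" unfolding l1_energy_def
    by (rule sum_mono2) (use simple_graph_finite_edges[OF G(1)] edge_diff_nonneg[OF G(1)] in auto)
  finally show ?thesis .
qed

section \<open>Upper bound from a single-edge cut\<close>

text \<open>The test vector is constant on \<open>S\<close> and on its complement, with totals
  \<open>1/2\<close> and \<open>- 1/2\<close>. Every edge other than \<open>{a, b}\<close> stays on
  one side and contributes nothing.\<close>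

lemma l1_fiedler_le_of_single_edge_cut:
  fixes G :: "'a ugraph"
  assumes G: "simple_graph G" and S: "S \<subseteq> verts G" "S \<noteq> {}" "S \<noteq> verts G"
    and cut: "\<And>f. f \<in> edges G \<Longrightarrow> f \<noteq> {a, b} \<Longrightarrow> f \<subseteq> S \<or> f \<inter> S = {}"
  shows "l1_fiedler G \<le> card (verts G) / (2 * card S * (card (verts G) - card S))"
proof -
  let ?V = "verts G"
  define s t where "s = card S" and "t = card (?V - S)"
  have fin: "finite ?V" "finite S" using G S finite_subset by (auto simp: simple_graph_def)
  then have st: "s > 0" "t > 0" "card ?V = s + t" "card ?V - card S = t"
    using S card_mono[OF fin(1) S(1)] card_subset_eq[OF fin(1) S(1)]
    by (auto simp: s_def t_def card_gt_0_iff card_Diff_subset)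
  define x :: "'a \<Rightarrow> real" where "x = (\<lambda>v. if v \<in> S then 1 / (2 * s) else - 1 / (2 * t))"
  have split: "(\<Sum>v\<in>?V. g v) = (\<Sum>v\<in>S. g v) + (\<Sum>v\<in>?V - S. g v)" for g :: "'a \<Rightarrow> real"
    using sum.subset_diff[OF S(1) fin(1), of g] by simp
  have "(\<Sum>v\<in>S. x v) = (\<Sum>v\<in>S. 1 / (2 * s))" "(\<Sum>v\<in>?V - S. x v) = (\<Sum>v\<in>?V - S. - 1 / (2 * t))"
    "(\<Sum>v\<in>S. \<bar>x v\<bar>) = (\<Sum>v\<in>S. 1 / (2 * s))" "(\<Sum>v\<in>?V - S. \<bar>x v\<bar>) = (\<Sum>v\<in>?V - S. 1 / (2 * t))"
    by (auto intro!: sum.cong simp: x_def)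
  then have "x \<in> l1_feasible G"
    using st by (simp add: l1_feasible_def split flip: s_def t_def)
  then have "l1_fiedler G \<le> l1_energy G x"
    using l1_fiedler_is_min(2)[OF G] st by simp
  also have "\<dots> \<le> (\<Sum>e\<in>{{a, b}}. edge_diff x e)"
  proof -
    have "edge_diff x f = 0" if f: "f \<in> edges G" "f \<noteq> {a, b}" for f
    proof -
      obtain u v where "f = {u, v}" using G f(1) by (rule simple_graph_edgeE)
      with cut[OF f] show ?thesis by (auto simp: edge_diff_doubleton x_def)
    qed
    then have "l1_energy G x = (\<Sum>e\<in>edges G \<inter> {{a, b}}. edge_diff x e)"
      unfolding l1_energy_def
      by (intro sum.mono_neutral_right) (use simple_graph_finite_edges[OF G] in auto)
    also have "\<dots> \<le> (\<Sum>e\<in>{{a, b}}. edge_diff x e)"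
      by (rule sum_mono2) (auto simp: edge_diff_doubleton)
    finally show ?thesis .
  qed
  also have "\<dots> \<le> 1 / (2 * s) + 1 / (2 * t)"
  proof -
    \<comment> \<open>This range bounds the difference between \<open>a\<close> and
      \<open>b\<close>, whichever sides they lie on.\<close>
    have "- (1 / (2 * t)) \<le> x v \<and> x v \<le> 1 / (2 * s)" for v
      by (auto simp: x_def intro: order_trans[of _ 0])
    from this[of a] this[of b] show ?thesis by (simp add: edge_diff_doubleton abs_le_iff)
  qed
  also have "\<dots> = card ?V / (2 * card S * (card ?V - card S))"
    using st by (simp add: field_simps flip: s_def)
  finally show ?thesis .
qed

section \<open>Balanced splits: the path and the lower bound\<close>

text \<open>With \<open>h = n div 2\<close>, the difference of the two products is
  \<open>(h - p) * (n - h - p)\<close>, whose factors never have opposite signs.\<close>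

lemma mult_diff_le_half:
  fixes p n :: nat
  assumes "p \<le> n"
  shows "p * (n - p) \<le> (n div 2) * (n - n div 2)"
proof -
  define h where "h = n div 2"
  have n: "n = 2 * h \<or> n = 2 * h + 1" unfolding h_def by presburger
  have "0 \<le> (int h - int p) * (int n - int h - int p)"
  proof (cases "p \<le> h")
    case True
    with n show ?thesis by (intro mult_nonneg_nonneg) auto
  next
    case False
    with n show ?thesis by (intro mult_nonpos_nonpos) auto
  qed
  then have "int p * (int n - int p) \<le> int h * (int n - int h)"
    by (simp add: algebra_simps)
  then have "int (p * (n - p)) \<le> int (h * (n - h))"
    using assms n by (auto simp: of_nat_diff add.commute)
  then show ?thesis by (simp only: of_nat_le_iff h_def)
qed

lemma l1_fiedler_path_graph_le:
  assumes "n \<ge> 2"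
  shows "l1_fiedler (path_graph n) \<le> n / (2 * real (n div 2 * (n - n div 2)))"
proof -
  define h where "h = n div 2"
  have h: "0 < h" "h < n" using assms by (auto simp: h_def)
  have "l1_fiedler (path_graph n) \<le>
    card (verts (path_graph n)) / (2 * card {..<h} * (card (verts (path_graph n)) - card {..<h}))"
  proof (rule l1_fiedler_le_of_single_edge_cut)
    show "simple_graph (path_graph n)" using is_tree_path_graph assms by (simp add: is_tree_def)
    show "{..<h} \<subseteq> verts (path_graph n)" "{..<h} \<noteq> {}" "{..<h} \<noteq> verts (path_graph n)"
      using h by (auto simp: path_graph_def)
    \<comment> \<open>The middle edge \<open>{h - 1, h}\<close> is the only one that leaves
      \<open>{..<h}\<close>.\<close>
    fix f assume f: "f \<in> edges (path_graph n)" "f \<noteq> {h - 1, h}"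
    then obtain i where i: "f = {i, Suc i}" by (auto simp: path_graph_def)
    with f h have "Suc i \<noteq> h" by auto
    with i show "f \<subseteq> {..<h} \<or> f \<inter> {..<h} = {}" by auto
  qed
  then show ?thesis using h by (simp add: path_graph_def mult.assoc flip: h_def)
qed

lemma energy_ge_of_connected:
  fixes G :: "'a ugraph"
  assumes G: "simple_graph G" "connected_graph G" and x: "x \<in> l1_feasible G"
  defines "n \<equiv> card (verts G)"
  shows "n / (2 * real (n div 2 * (n - n div 2))) \<le> l1_energy G x"
proof -
  let ?V = "verts G"
  define P where "P = {v \<in> ?V. x v > 0}"
  \<comment> \<open>Zero entries go to \<open>N\<close>, where the absolute value is still the
    negation.\<close>
  define N where "N = ?V - P"
  have fin: "finite ?V" "finite P" "finite N" using G by (auto simp: simple_graph_def P_def N_def)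
  have split: "(\<Sum>v\<in>?V. g v) = (\<Sum>v\<in>P. g v) + (\<Sum>v\<in>N. g v)" for g :: "'a \<Rightarrow> real"
    unfolding N_def using sum.subset_diff[of P ?V g] fin by (simp add: P_def)
  have "(\<Sum>v\<in>P. \<bar>x v\<bar>) = (\<Sum>v\<in>P. x v)" "(\<Sum>v\<in>N. \<bar>x v\<bar>) = (\<Sum>v\<in>N. - x v)"
    by (auto intro!: sum.cong simp: P_def N_def)
  then have sums: "(\<Sum>v\<in>P. x v) = 1/2" "(\<Sum>v\<in>N. x v) = - 1/2"
    using x by (auto simp: l1_feasible_def split sum_negf)
  then have ne: "P \<noteq> {}" "N \<noteq> {}" by auto
  define p where "p = card P"
  have pn: "0 < p" "p < n" "card N = n - p"
  proof -
    have "card ?V = card P + card N"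
      using split[of "\<lambda>_. 1"] by (simp flip: of_nat_add)
    then show "0 < p" "p < n" "card N = n - p"
      using ne fin by (auto simp: p_def n_def card_gt_0_iff)
  qed
  \<comment> \<open>Some entry on \<open>P\<close> is at least the average there; the same argument
    gives \<open>w\<close> on \<open>N\<close>.\<close>
  obtain u where u: "u \<in> P" "1 / (2 * p) \<le> x u"
  proof -
    have "\<exists>u\<in>P. 1 / (2 * p) \<le> x u"
    proof (rule ccontr)
      assume "\<not> ?thesis"
      then have "(\<Sum>v\<in>P. x v) < (\<Sum>v\<in>P. 1 / (2 * p))"
        by (intro sum_strict_mono) (use ne fin in auto)
      with sums pn show False by (simp flip: p_def)
    qed
    then show thesis using that by blast
  qed
  obtain w where w: "w \<in> N" "x w \<le> - 1 / (2 * (n - p))"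
  proof -
    have "\<exists>w\<in>N. x w \<le> - 1 / (2 * (n - p))"
    proof (rule ccontr)
      assume "\<not> ?thesis"
      then have "(\<Sum>v\<in>N. - 1 / (2 * (n - p))) < (\<Sum>v\<in>N. x v)"
        by (intro sum_strict_mono) (use ne fin in auto)
      with sums pn show False by simp
    qed
    then show thesis using that by blast
  qed
  \<comment> \<open>Passing from the balanced split to the actual one can only shrink the
    denominator.\<close>
  have "n / (2 * real (n div 2 * (n - n div 2))) \<le> n / (2 * real (p * (n - p)))"
    using pn mult_diff_le_half[of p n]
    by (intro divide_left_mono mult_left_mono mult_pos_pos of_nat_mono) auto
  also have "\<dots> = 1 / (2 * p) + 1 / (2 * (n - p))"
    using pn by (simp add: field_simps of_nat_diff)
  also have "\<dots> \<le> x u - x w" using u w by simp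
  also have "\<dots> \<le> l1_energy G x"
    using diff_le_l1_energy[OF G, of u w x] u w by (auto simp: P_def N_def)
  finally show ?thesis .
qed

section \<open>Cutting a tree at an edge\<close>

text \<open>\<open>S\<close> is the component of \<open>u\<close> once the edge
  \<open>{u, v}\<close> is deleted. A path from \<open>u\<close> to \<open>v\<close> avoiding that
  edge would be closed by it to a cycle.\<close>

lemma tree_edge_component:
  assumes T: "is_tree T" and uv: "adj T u v"
  obtains S where "S \<subseteq> verts T" "u \<in> S" "v \<notin> S"
    "\<And>f. f \<in> edges T \<Longrightarrow> f \<noteq> {u, v} \<Longrightarrow> f \<subseteq> S \<or> f \<inter> S = {}"
proof -
  define R where "R = (\<lambda>a b. adj T a b \<and> {a, b} \<noteq> {u, v})"
  define S where "S = {w. R\<^sup>*\<^sup>* u w}"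
  have G: "simple_graph T" using T by (simp add: is_tree_def)
  have "w \<in> verts T" if "R\<^sup>*\<^sup>* u w" for w
    using that
  proof (induction rule: rtranclp_induct)
    case base
    show ?case using simple_graph_adjD(1)[OF G uv] .
  next
    case (step y z)
    then show ?case using simple_graph_adjD(2)[OF G, of y z] by (simp add: R_def)
  qed
  then have "S \<subseteq> verts T" by (auto simp: S_def)
  moreover have "u \<in> S" by (simp add: S_def)
  moreover have "v \<notin> S"
  proof
    assume "v \<in> S"
    then have "R\<^sup>*\<^sup>* u v" by (simp add: S_def)
    then obtain p where p: "p \<noteq> []" "distinct p" "successively R p" "hd p = u" "last p = v"
      by (rule rtranclp_imp_distinct_path)
    have "u \<noteq> v" by (rule simple_graph_adjD(3)[OF G uv])
    with p obtain a q where q: "p = u # a # q" by (cases p rule: remdups_adj.cases) auto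
    \<comment> \<open>The path consisting of \<open>u\<close> and \<open>v\<close> alone would use
      the deleted edge; hence at least three vertices, as \<open>is_cycle\<close> demands.\<close>
    with p have "q \<noteq> []" by (auto simp: R_def)
    then have "length p \<ge> 3" using q by (cases q) auto
    moreover have "successively (adj T) p"
      using p(3) by (rule successively_mono) (simp add: R_def)
    ultimately have "is_cycle T p"
      using p uv adj_commute[of T u v] by (simp add: is_cycle_def)
    then show False using T by (auto simp: is_tree_def)
  qed
  moreover have "f \<subseteq> S \<or> f \<inter> S = {}" if f: "f \<in> edges T" "f \<noteq> {u, v}" for f
  proof -
    obtain a b where ab: "f = {a, b}" using G f(1) by (rule simple_graph_edgeE)
    then have "R a b" "R b a" using f by (auto simp: R_def adj_def insert_commute)
    then have "a \<in> S \<longleftrightarrow> b \<in> S"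
      unfolding S_def by (metis mem_Collect_eq rtranclp.rtrancl_into_rtrancl)
    then show ?thesis using ab by auto
  qed
  ultimately show thesis using that by blast
qed

text \<open>The product exceeds \<open>n - 1\<close> by exactly
  \<open>(s - 1) * (n - s - 1)\<close>.\<close>

lemma pred_le_mult_diff:
  fixes s n :: nat
  assumes "0 < s" "s < n"
  shows "n - 1 \<le> s * (n - s)" and "2 \<le> s \<Longrightarrow> 2 \<le> n - s \<Longrightarrow> n - 1 < s * (n - s)"
proof -
  obtain i j where "s = Suc i" "n = Suc i + Suc j"
    using assms by (metis Suc_pred' less_imp_add_positive)
  then show "n - 1 \<le> s * (n - s)" "2 \<le> s \<Longrightarrow> 2 \<le> n - s \<Longrightarrow> n - 1 < s * (n - s)" by auto
qed

definition leaf :: "'a ugraph \<Rightarrow> 'a \<Rightarrow> bool" where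
  "leaf G u \<longleftrightarrow> (\<exists>!v. adj G u v)"

text \<open>Any edge at \<open>u\<close> meets \<open>{u}\<close> without lying inside it, so by
  \<open>cut\<close> it can only be \<open>{u, v}\<close>.\<close>

lemma leaf_of_singleton_component:
  assumes "simple_graph G" "adj G u v"
    and cut: "\<And>f. f \<in> edges G \<Longrightarrow> f \<noteq> {u, v} \<Longrightarrow> f \<subseteq> {u} \<or> f \<inter> {u} = {}"
  shows "leaf G u"
  unfolding leaf_def
proof (rule ex1I)
  show "adj G u v" by (rule assms(2))
  fix w assume w: "adj G u w"
  then have "u \<noteq> w" by (rule simple_graph_adjD[OF assms(1)])
  then show "w = v" using cut[of "{u, w}"] w by (auto simp: adj_def doubleton_eq_iff)
qed

text \<open>Both parts cut the tree at \<open>{u, v}\<close>. The sizes of the sides have product at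
  least \<open>n - 1\<close>, and more unless one side is a single vertex, which is then a leaf. The
  strict alternative is what uniqueness rests on.\<close>

lemma l1_fiedler_tree_edge:
  assumes T: "is_tree T" and uv: "adj T u v"
  defines "n \<equiv> card (verts T)"
  shows "l1_fiedler T \<le> n / (2 * real (n - 1))"
    and "leaf T u \<or> leaf T v \<or> l1_fiedler T < n / (2 * real (n - 1))"
proof -
  have G: "simple_graph T" using T by (simp add: is_tree_def)
  then have fin: "finite (verts T)" by (simp add: simple_graph_def)
  have inV: "u \<in> verts T" "v \<in> verts T" using simple_graph_adjD[OF G uv] by auto
  obtain S where S: "S \<subseteq> verts T" "u \<in> S" "v \<notin> S"
    and cut: "\<And>f. f \<in> edges T \<Longrightarrow> f \<noteq> {u, v} \<Longrightarrow> f \<subseteq> S \<or> f \<inter> S = {}"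
    using tree_edge_component[OF T uv] by blast
  define s where "s = card S"
  have "finite S" using S fin finite_subset by blast
  have "S \<subset> verts T" using S inV by auto
  then have s: "0 < s" "s < n"
    using S \<open>finite S\<close> psubset_card_mono[OF fin] by (auto simp: s_def n_def card_gt_0_iff)
  have le: "l1_fiedler T \<le> n / (2 * real (s * (n - s)))"
    using l1_fiedler_le_of_single_edge_cut[OF G S(1) _ _ cut] S inV
    by (fastforce simp: n_def s_def mult.assoc)
  also have "\<dots> \<le> n / (2 * real (n - 1))"
    using s pred_le_mult_diff(1)[OF s]
    by (intro divide_left_mono mult_left_mono mult_pos_pos of_nat_mono) auto
  finally show "l1_fiedler T \<le> n / (2 * real (n - 1))" .
  consider "s = 1" | "n - s = 1" | "2 \<le> s" "2 \<le> n - s" using s by linarith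
  then show "leaf T u \<or> leaf T v \<or> l1_fiedler T < n / (2 * real (n - 1))"
  proof cases
    case 1
    then have "S = {u}" using S by (metis s_def card_1_singletonE singletonD)
    then have "leaf T u" using leaf_of_singleton_component[OF G uv] cut by blast
    then show ?thesis ..
  next
    case 2
    then have "card (verts T - S) = 1" using S \<open>finite S\<close> by (simp add: card_Diff_subset s_def n_def)
    then have V: "verts T - S = {v}" using S inV by (metis DiffI card_1_singletonE singletonD)
    have "leaf T v"
    proof (rule leaf_of_singleton_component[OF G])
      show "adj T v u" using uv by (simp add: adj_commute)
      fix f assume f: "f \<in> edges T" "f \<noteq> {v, u}"
      then have "f \<subseteq> verts T" using G by (auto simp: simple_graph_def)
      then show "f \<subseteq> {v} \<or> f \<inter> {v} = {}" using cut[of f] f V S by (auto simp: insert_commute)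
    qed
    then show ?thesis by simp
  next
    case 3
    note le
    also have "n / (2 * real (s * (n - s))) < n / (2 * real (n - 1))"
      using s pred_le_mult_diff(2)[OF s 3]
      by (intro divide_strict_left_mono mult_strict_left_mono mult_pos_pos)
        (auto simp flip: of_nat_mult simp del: of_nat_diff)
    finally show ?thesis by simp
  qed
qed

section \<open>The value for the star\<close>

lemma l1_energy_star_graph: "l1_energy (star_graph n) x = (\<Sum>i\<in>{0<..<n}. \<bar>x i - x 0\<bar>)"
proof -
  have "edges (star_graph n) = (\<lambda>i. {0, i}) ` {0<..<n}" by (auto simp: star_graph_def)
  moreover have "inj_on (\<lambda>i. {0, i}) {0<..<n}" by (auto simp: inj_on_def doubleton_eq_iff)
  ultimately show ?thesis
    by (simp add: l1_energy_def sum.reindex edge_diff_doubleton abs_minus_commute)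
qed

text \<open>
  The two bounds \<open>n x\<^sub>0\<close> and \<open>1 - (n - 2) x\<^sub>0\<close> on the energy cross at \<open>x\<^sub>0 = 1 / (2 (n - 1))\<close>.
\<close>

lemma star_sum_ge:
  fixes x :: "nat \<Rightarrow> real"
  assumes n: "n \<ge> 2" and sum0: "(\<Sum>i<n. x i) = 0" and sum1: "(\<Sum>i<n. \<bar>x i\<bar>) = 1" and c: "x 0 \<ge> 0"
  shows "n / (2 * real (n - 1)) \<le> (\<Sum>i\<in>{0<..<n}. \<bar>x i - x 0\<bar>)"
proof -
  let ?L = "{0<..<n}"
  define E where "E = (\<Sum>i\<in>?L. \<bar>x i - x 0\<bar>)"
  have V: "{..<n} = insert 0 ?L" using n by auto
  have sums: "(\<Sum>i\<in>?L. x i) = - x 0" "(\<Sum>i\<in>?L. \<bar>x i\<bar>) = 1 - x 0"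
    using sum0 sum1 c by (auto simp: V)
  have "(\<Sum>i\<in>?L. x 0 - x i) = n * x 0"
    using n by (simp add: sum_subtractf sums of_nat_diff algebra_simps)
  moreover have "(\<Sum>i\<in>?L. x 0 - x i) \<le> E"
    unfolding E_def by (intro sum_mono) auto
  ultimately have E1: "n * x 0 \<le> E" by simp
  \<comment> \<open>The entries off the centre sum to \<open>- x 0\<close>, so they cannot all be
    positive.\<close>
  have "\<exists>j\<in>?L. x j \<le> 0"
  proof (rule ccontr)
    assume "\<not> ?thesis"
    moreover have "1 \<in> ?L" using n by auto
    ultimately have "(\<Sum>i\<in>?L. x i) > 0" by (intro sum_pos) (auto simp: not_le)
    with sums c show False by simp
  qed
  then obtain j where j: "j \<in> ?L" "x j \<le> 0" by blast
  \<comment> \<open>The reverse triangle inequality loses \<open>2 * x 0\<close> at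
    \<open>j\<close>, where the two entries have opposite signs; the extra term restores it.\<close>
  have "(\<Sum>i\<in>?L. \<bar>x i\<bar> - x 0 + (if i = j then 2 * x 0 else 0)) \<le> E"
    unfolding E_def by (intro sum_mono) (use j c in auto)
  moreover have "(\<Sum>i\<in>?L. \<bar>x i\<bar> - x 0 + (if i = j then 2 * x 0 else 0)) = 1 - (real n - 2) * x 0"
    using j n by (simp add: sum.distrib sum_subtractf sums of_nat_diff algebra_simps)
  ultimately have E2: "1 - (real n - 2) * x 0 \<le> E" by simp
  \<comment> \<open>Adding these multiples of \<open>E1\<close> and \<open>E2\<close> eliminates
    \<open>x 0\<close>.\<close>
  have "(real n - 2) * (n * x 0) \<le> (real n - 2) * E" "n * (1 - (real n - 2) * x 0) \<le> n * E"
    using E1 E2 n by (auto intro!: mult_left_mono)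
  then have "n \<le> 2 * (real n - 1) * E" by (simp add: algebra_simps)
  then show ?thesis using n by (simp add: E_def[symmetric] field_simps of_nat_diff)
qed

lemma l1_fiedler_star_graph_ge:
  assumes n: "n \<ge> 2"
  shows "n / (2 * real (n - 1)) \<le> l1_fiedler (star_graph n)"
proof -
  have "simple_graph (star_graph n)" using is_tree_star_graph[of n] n by (simp add: is_tree_def)
  moreover have "card (verts (star_graph n)) \<ge> 2" using n by (simp add: star_graph_def)
  ultimately obtain x where x: "x \<in> l1_feasible (star_graph n)"
    and b: "l1_fiedler (star_graph n) = l1_energy (star_graph n) x"
    using l1_fiedler_is_min(1) by blast
  have x': "(\<Sum>i<n. x i) = 0" "(\<Sum>i<n. \<bar>x i\<bar>) = 1"
    using x by (auto simp: l1_feasible_def star_graph_def)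
  show ?thesis
  proof (cases "x 0 \<ge> 0")
    case True
    then show ?thesis using star_sum_ge[OF n x'] by (simp add: b l1_energy_star_graph)
  next
    case False
    \<comment> \<open>Feasibility and energy are invariant under a change of sign.\<close>
    then show ?thesis using star_sum_ge[OF n, of "\<lambda>i. - x i"] x'
      by (simp add: b l1_energy_star_graph sum_negf abs_minus_commute)
  qed
qed

section \<open>Trees attaining the maximum\<close>

lemma connected_graph_adj_exists:
  assumes "connected_graph G" "card (verts G) \<ge> 2"
  obtains u v where "adj G u v"
proof -
  obtain A where "A \<subseteq> verts G" "card A = 2"
    using assms(2) by (metis obtain_subset_with_card_n)
  then obtain a b where ab: "a \<in> verts G" "b \<in> verts G" "a \<noteq> b" by (auto simp: card_2_iff)
  then have "(adj G)\<^sup>*\<^sup>* a b" using assms(1) by (simp add: connected_graph_def)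
  then show thesis using ab(3) that by (metis converse_rtranclpE)
qed

text \<open>The neighbour \<open>c\<close> of some leaf serves as centre. All neighbours of
  \<open>c\<close> are leaves, so connectedness allows no vertex at distance two from
  \<open>c\<close>.\<close>

lemma graph_iso_star_if_edges_pendant:
  assumes G: "simple_graph G" "connected_graph G" and n: "card (verts G) \<ge> 2"
    and pendant: "\<And>u v. adj G u v \<Longrightarrow> leaf G u \<or> leaf G v"
  shows "graph_iso G (star_graph (card (verts G)))"
proof -
  define n where "n = card (verts G)"
  have fin: "finite (verts G)" using G by (simp add: simple_graph_def)
  obtain c v where cv: "adj G c v" "leaf G v"
    using connected_graph_adj_exists[OF G(2) n] pendant by (metis adj_commute)
  then have c: "c \<in> verts G" using simple_graph_adjD[OF G(1)] by blast
  \<comment> \<open>If \<open>c\<close> is itself the leaf, then \<open>w\<close> is its only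
    neighbour \<open>v\<close>, which is a leaf too.\<close>
  have leaf_nbr: "leaf G w" if "adj G c w" for w
    using pendant[OF that] cv that unfolding leaf_def by metis
  \<comment> \<open>A walk that has reached a leaf next to \<open>c\<close> can only return to
    \<open>c\<close>.\<close>
  have nbr: "w = c \<or> adj G c w" if "(adj G)\<^sup>*\<^sup>* c w" for w
    using that
  proof (induction rule: rtranclp_induct)
    case (step y z)
    then show ?case using leaf_nbr[of y] adj_commute[of G] unfolding leaf_def by metis
  qed simp
  then have centre: "adj G c w" if "w \<in> verts G" "w \<noteq> c" for w
    using that c G(2) by (auto simp: connected_graph_def)
  have adj_iff: "adj G a b \<longleftrightarrow> (a = c) \<noteq> (b = c)" if "a \<in> verts G" "b \<in> verts G" for a b
  proof (cases "a = c \<or> b = c")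
    case True
    then show ?thesis using centre that simple_graph_adjD(3)[OF G(1)] adj_commute[of G] by metis
  next
    case False
    then have "leaf G a" "adj G a c" using centre leaf_nbr that adj_commute[of G] by metis+
    then show ?thesis using False unfolding leaf_def by metis
  qed
  \<comment> \<open>The other vertices may be numbered arbitrarily; only \<open>0\<close> is special
    in the star.\<close>
  have "card (verts G - {c}) = card {0<..<n}" using c fin by (simp add: n_def)
  then obtain g where g: "bij_betw g (verts G - {c}) {0<..<n}"
    using finite_same_card_bij[of "verts G - {c}" "{0<..<n}"] fin by auto
  define f where "f = (\<lambda>w. if w = c then 0 else g w)"
  have "bij_betw f (verts G - {c}) {0<..<n}"
    using g by (subst bij_betw_cong[of _ _ g]) (auto simp: f_def)
  then have "bij_betw f (insert c (verts G - {c})) (insert 0 {0<..<n})"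
    using notIn_Un_bij_betw[of c "verts G - {c}" f "{0<..<n}"] by (simp add: f_def)
  moreover have "insert c (verts G - {c}) = verts G" using c by auto
  moreover have "insert 0 {0<..<n} = {..<n}" using n by (auto simp: n_def)
  ultimately have bij: "bij_betw f (verts G) {..<n}" by simp
  have pos: "f w = 0 \<longleftrightarrow> w = c" "f w < n" if "w \<in> verts G" for w
  proof -
    have "g w \<in> {0<..<n}" if "w \<noteq> c"
      using bij_betwE[OF g] that \<open>w \<in> verts G\<close> by simp
    then show "f w = 0 \<longleftrightarrow> w = c" by (auto simp: f_def)
    show "f w < n" using bij_betwE[OF bij] \<open>w \<in> verts G\<close> by simp
  qed
  have "adj G a b \<longleftrightarrow> adj (star_graph n) (f a) (f b)" if "a \<in> verts G" "b \<in> verts G" for a b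
    using pos[OF that(1)] pos[OF that(2)] adj_iff[OF that] unfolding adj_star_graph neq0_conv[symmetric]
    by metis
  with bij show ?thesis unfolding graph_iso_def n_def by (auto simp: star_graph_def)
qed

theorem theorem4p2:
  fixes n :: nat
  assumes "n \<ge> 2"
  shows "is_tree (path_graph n) \<and> card (verts (path_graph n)) = n \<and>
    is_tree (star_graph n) \<and> card (verts (star_graph n)) = n \<and>
    (\<forall>T :: 'a ugraph. is_tree T \<and> card (verts T) = n \<longrightarrow>
       l1_fiedler (path_graph n) \<le> l1_fiedler T \<and>
       l1_fiedler T \<le> l1_fiedler (star_graph n)) \<and>
    (\<forall>T :: 'a ugraph. is_tree T \<and> card (verts T) = n \<and>
       l1_fiedler T = l1_fiedler (star_graph n) \<longrightarrow> graph_iso T (star_graph n))"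
proof -
  have lower: "l1_fiedler (path_graph n) \<le> l1_fiedler T"
    if T: "is_tree T" "card (verts T) = n" for T :: "'a ugraph"
  proof -
    have "simple_graph T" "connected_graph T" using T by (auto simp: is_tree_def)
    then have "n / (2 * real (n div 2 * (n - n div 2))) \<le> l1_fiedler T"
      using l1_fiedler_is_min(1)[of T] energy_ge_of_connected[of T] T assms by auto
    then show ?thesis using l1_fiedler_path_graph_le[OF assms] by simp
  qed
  have upper: "l1_fiedler T \<le> l1_fiedler (star_graph n)"
    if T: "is_tree T" "card (verts T) = n" for T :: "'a ugraph"
  proof -
    obtain u v where "adj T u v"
      using connected_graph_adj_exists[of T] T assms by (auto simp: is_tree_def)
    then show ?thesis
      using l1_fiedler_tree_edge(1)[OF T(1)] l1_fiedler_star_graph_ge[OF assms] T by fastforce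
  qed
  have unique: "graph_iso T (star_graph n)"
    if T: "is_tree T" "card (verts T) = n" "l1_fiedler T = l1_fiedler (star_graph n)"
    for T :: "'a ugraph"
  proof -
    \<comment> \<open>Equality with the star, whose value is at least
      \<open>n / (2 * real (n - 1))\<close>, excludes the strict alternative.\<close>
    have "leaf T u \<or> leaf T v" if "adj T u v" for u v
      using l1_fiedler_tree_edge(2)[OF T(1) that] l1_fiedler_star_graph_ge[OF assms] T by auto
    then show ?thesis
      using graph_iso_star_if_edges_pendant[of T] T assms by (auto simp: is_tree_def)
  qed
  show ?thesis
    using assms lower upper unique is_tree_path_graph[of n] is_tree_star_graph[of n]
    by (auto simp: path_graph_def star_graph_def)
qed

end
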